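(* Let $k\ge1$ and $0\le j\le k-1$. The polynomial $p_{k,j}\in\mathbb{F}_2[x_1,\ldots,x_k]$ (the case $\ell=k$ of $p_{\ell,j}$) equals the sum of all monomials of degree $2^k-2^j$ in $x_1,\ldots,x_k$ in which all nonzero exponents are $2$-powers.
   Context: For $\ell\ge k$ and $0\le j\le k-1$, $p_{\ell,j}\in\mathbb{F}_2[x_1,\ldots,x_k]$ is the polynomial $$p_{\ell,j}=\frac{m_{2^0,\ldots,\widehat{2^j},\ldots,2^{k-1},2^\ell}}{m_{2^0,\ldots,2^{k-1}}},$$ where the hat denotes omission and $m_{t_1,\ldots,t_k}$ is the monomial symmetric polynomial over $\mathbb{F}_2$ in $x_1,\ldots,x_k$ (the sum of all distinct monomials obtained from $x_1^{t_1}\cdots x_k^{t_k}$ by permuting the variables); these ratios are known to be polynomials. The degree of each $x_i$ is $1$, and $2$-powers include $2^0=1$. *)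

theory Defs
  imports "HOL-Library.Poly_Mapping" "HOL-Library.Z2" "HOL-Combinatorics.Permutations"
begin

text \<open>
  An exponent vector is a finitely supported map from variable indices to exponents, and a
  polynomial is a finitely supported map from exponent vectors to coefficients; multiplication
  on the latter type is convolution. The variables are indexed by positive integers, so the
  polynomial ring over the two-element field \<open>bit\<close> in \<open>x\<^sub>1, \<dots>, x\<^sub>k\<close> is \<open>F2_poly_ring k\<close>.
\<close>

type_synonym expvec = "nat \<Rightarrow>\<^sub>0 nat"
type_synonym F2_mpoly = "expvec \<Rightarrow>\<^sub>0 bit"

definition expvecs :: "nat \<Rightarrow> expvec set" where
  "expvecs k = {a. Poly_Mapping.keys a \<subseteq> {1..k}}"

definition F2_poly_ring :: "nat \<Rightarrow> F2_mpoly set" where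
  "F2_poly_ring k = {q. Poly_Mapping.keys q \<subseteq> expvecs k}"

definition monomial :: "expvec \<Rightarrow> F2_mpoly" where
  "monomial a = Poly_Mapping.single a 1"

definition total_degree :: "expvec \<Rightarrow> nat" where
  "total_degree a = (\<Sum>i\<in>Poly_Mapping.keys a. Poly_Mapping.lookup a i)"

text \<open>
  The exponent vectors of the monomials obtained from \<open>x\<^sub>1^t\<^sub>1 \<cdots> x\<^sub>k^t\<^sub>k\<close> by permuting the
  variables, where \<open>k\<close> is the length of the list \<open>ts\<close> (which is indexed from \<open>0\<close>).
  They form a set, so that each distinct monomial is counted once in \<open>monomial_sym\<close>.
\<close>

definition permuted_expvecs :: "nat list \<Rightarrow> expvec set" where
  "permuted_expvecs ts =
     {(\<Sum>i = 1..length ts. Poly_Mapping.single (\<sigma> i) (ts ! (i - 1))) | \<sigma>.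
        \<sigma> permutes {1..length ts}}"

definition monomial_sym :: "nat list \<Rightarrow> F2_mpoly" where
  "monomial_sym ts = (\<Sum>a\<in>permuted_expvecs ts. monomial a)"

definition p_denominator :: "nat \<Rightarrow> F2_mpoly" where
  "p_denominator k = monomial_sym (map (\<lambda>i. 2 ^ i) [0..<k])"

definition p_numerator :: "nat \<Rightarrow> nat \<Rightarrow> nat \<Rightarrow> F2_mpoly" where
  "p_numerator k l j = monomial_sym (map (\<lambda>i. 2 ^ i) ([0..<j] @ [Suc j..<k] @ [l]))"

text \<open>
  The ratio of two polynomials, as an element of the polynomial ring. It is unique if it exists:
  see \<open>p_poly_unique\<close> below. The parameter \<open>k\<close> is the number of variables; only
  \<open>j < k \<le> l\<close> is meaningful.
\<close>

definition p_poly :: "nat \<Rightarrow> nat \<Rightarrow> nat \<Rightarrow> F2_mpoly" where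
  "p_poly k l j = (THE q. q \<in> F2_poly_ring k \<and> q * p_denominator k = p_numerator k l j)"

definition two_power_expvecs :: "nat \<Rightarrow> nat \<Rightarrow> expvec set" where
  "two_power_expvecs k d =
     {a \<in> expvecs k. total_degree a = d \<and>
        (\<forall>i\<in>{1..k}. Poly_Mapping.lookup a i \<noteq> 0 \<longrightarrow> (\<exists>r. Poly_Mapping.lookup a i = 2 ^ r))}"

text \<open>The index sets of the sums are finite, so the sums are not degenerate.\<close>

lemma finite_permuted_expvecs: "finite (permuted_expvecs ts)"
proof -
  have "permuted_expvecs ts =
      (\<lambda>\<sigma>. \<Sum>i = 1..length ts. Poly_Mapping.single (\<sigma> i) (ts ! (i - 1))) `
        {\<sigma>. \<sigma> permutes {1..length ts}}"
    unfolding permuted_expvecs_def by blast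
  then show ?thesis by (simp add: finite_permutations)
qed

lemma finite_two_power_expvecs: "finite (two_power_expvecs k d)"
proof -
  let ?F = "{f. \<forall>i. (i \<in> {1..k} \<longrightarrow> f i \<in> {..d}) \<and> (i \<notin> {1..k} \<longrightarrow> f i = (0::nat))}"
  have "Poly_Mapping.lookup a \<in> ?F" if "a \<in> two_power_expvecs k d" for a
  proof -
    have keys: "Poly_Mapping.keys a \<subseteq> {1..k}" and deg: "total_degree a = d"
      using that by (auto simp: two_power_expvecs_def expvecs_def)
    have "Poly_Mapping.lookup a i \<le> d" if "i \<in> Poly_Mapping.keys a" for i
      using member_le_sum[OF that, of "Poly_Mapping.lookup a"] deg
      by (simp add: total_degree_def)
    moreover have "Poly_Mapping.lookup a i = 0" if "i \<notin> Poly_Mapping.keys a" for i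
      using that by (simp add: in_keys_iff)
    ultimately show ?thesis using keys by fastforce
  qed
  then have "Poly_Mapping.lookup ` two_power_expvecs k d \<subseteq> ?F" by (rule image_subsetI)
  moreover have "finite ?F" by (rule finite_set_of_finite_funs) auto
  ultimately have "finite (Poly_Mapping.lookup ` two_power_expvecs k d)"
    by (rule finite_subset)
  then show ?thesis
    by (rule finite_imageD) (auto intro!: inj_onI simp: poly_mapping_eqI)
qed

lemma lookup_monomial_sum:
  assumes "finite A"
  shows "Poly_Mapping.lookup (\<Sum>a\<in>A. monomial a) b = (if b \<in> A then 1 else 0)"
  using assms by (induction A) (auto simp: monomial_def lookup_add lookup_single when_def)

lemma p_denominator_nonzero: "p_denominator k \<noteq> 0"
proof -
  let ?ts = "map (\<lambda>i. 2 ^ i) [0..<k] :: nat list"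
  have "(\<Sum>i = 1..length ?ts. Poly_Mapping.single (id i) (?ts ! (i - 1))) \<in> permuted_expvecs ?ts"
    unfolding permuted_expvecs_def using permutes_id by blast
  then obtain b where b: "b \<in> permuted_expvecs ?ts" by blast
  have "Poly_Mapping.lookup (p_denominator k) b = 1"
    using b by (simp add: p_denominator_def monomial_sym_def
        lookup_monomial_sum[OF finite_permuted_expvecs])
  then show ?thesis by auto
qed

lemma p_poly_unique:
  assumes "q \<in> F2_poly_ring k" "q * p_denominator k = p_numerator k l j"
  shows "p_poly k l j = q"
  unfolding p_poly_def
proof (rule the_equality)
  show "q' = q" if "q' \<in> F2_poly_ring k \<and> q' * p_denominator k = p_numerator k l j" for q'
    using that assms(2) p_denominator_nonzero[of k] by (metis mult_right_cancel)
qed (use assms in blast)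

end

theory Submission
  imports Defs
begin

text \<open>
  Write \<open>Q\<^sub>t\<close> for the sum of all monomials of degree \<open>2^k - 2^t\<close> whose nonzero exponents are powers
  of two, so \<open>Q\<^sub>k = 1\<close>. The proof rests on the claim that every variable \<open>x\<^sub>i\<close> is a root of
  \<open>\<Sum>t\<le>k. Q\<^sub>t X^(2^t)\<close>, that is, in characteristic two,
  \<open>x\<^sub>i^(2^k) = (\<Sum>t<k. Q\<^sub>t * x\<^sub>i^(2^t))\<close> (\<open>two_power_relation\<close>).

  The terms of \<open>\<Sum>t\<le>k. Q\<^sub>t * x\<^sub>i^(2^t)\<close> are indexed by pairs \<open>(t, a)\<close>, and such a pair yields the
  monomial \<open>x^a * x\<^sub>i^(2^t)\<close>. The exponent of \<open>x\<^sub>i\<close> there is \<open>2^t + n\<close>, where \<open>n\<close> is zero or a power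
  of two, and it has exactly one other decomposition of this kind: exchange the summands if they are
  distinct powers, otherwise trade \<open>2^t + 0\<close> for \<open>2^(t-1) + 2^(t-1)\<close> or back. So the terms cancel
  in pairs. The only exponent without a partner is \<open>2^0 + 0\<close>; but then the other \<open>k - 1\<close>
  exponents would be zeros and powers of two with sum \<open>2^k - 1\<close>, which has \<open>k\<close> binary digits
  equal to one and therefore is not a sum of fewer than \<open>k\<close> powers of two
  (\<open>card_ge_if_two_power_sum\<close>).

  The rest is Cramer's rule. Numerator and denominator of \<open>p_poly\<close> are permanents, hence
  determinants in characteristic two, with the powers of the variables as columns. Expand
  \<open>x\<^sub>i^(2^k)\<close> in the last column of the numerator by the claim: the permanent with \<open>x\<^sub>i^(2^t)\<close> in the
  last column has two equal columns for \<open>t \<noteq> j\<close>, and it is the denominator with its columns permuted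
  for \<open>t = j\<close>. So the numerator is \<open>Q\<^sub>j\<close> times the denominator.
\<close>

section \<open>Sums of powers of two\<close>

definition two_power_or_zero :: "nat \<Rightarrow> bool" where
  "two_power_or_zero n \<longleftrightarrow> (n \<noteq> 0 \<longrightarrow> (\<exists>r. n = 2 ^ r))"

lemma two_power_or_zero_power [simp]: "two_power_or_zero (2 ^ r)"
  by (auto simp: two_power_or_zero_def)

lemma two_power_or_zero_0 [simp]: "two_power_or_zero 0"
  by (auto simp: two_power_or_zero_def)

fun binary_digit_sum :: "nat \<Rightarrow> nat" where
  "binary_digit_sum n = (if n = 0 then 0 else n mod 2 + binary_digit_sum (n div 2))"

declare binary_digit_sum.simps [simp del]

lemma binary_digit_sum_0 [simp]: "binary_digit_sum 0 = 0"
  by (simp add: binary_digit_sum.simps)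

lemma binary_digit_sum_rec: "binary_digit_sum n = n mod 2 + binary_digit_sum (n div 2)"
  by (cases "n = 0") (simp_all add: binary_digit_sum.simps[of n])

lemma binary_digit_sum_Suc_le: "binary_digit_sum (Suc n) \<le> Suc (binary_digit_sum n)"
proof (induction n rule: less_induct)
  case (less n)
  show ?case
  proof (cases "even n")
    case True
    then have "Suc n div 2 = n div 2" "Suc n mod 2 = 1" "n mod 2 = 0" by presburger+
    then show ?thesis
      by (simp add: binary_digit_sum_rec[of "Suc n"] binary_digit_sum_rec[of n])
  next
    case False
    then have "Suc n div 2 = Suc (n div 2)" "Suc n mod 2 = 0" "n mod 2 = 1" "n div 2 < n"
      by presburger+
    then show ?thesis
      using less.IH[of "n div 2"]
      by (simp add: binary_digit_sum_rec[of "Suc n"] binary_digit_sum_rec[of n])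
  qed
qed

text \<open>A new digit one appears in one position only; the carries before it just clear digits.\<close>

lemma binary_digit_sum_add_two_power_le:
  "binary_digit_sum (n + 2 ^ r) \<le> Suc (binary_digit_sum n)"
proof (induction r arbitrary: n)
  case 0
  then show ?case using binary_digit_sum_Suc_le[of n] by simp
next
  case (Suc r)
  have "(n + 2 ^ Suc r) div 2 = n div 2 + 2 ^ r" "(n + 2 ^ Suc r) mod 2 = n mod 2"
    by (simp_all add: mod_add_eq)
  then show ?case
    using Suc.IH[of "n div 2"]
    by (simp only: binary_digit_sum_rec[of "n + 2 ^ Suc r"] binary_digit_sum_rec[of n])
qed

lemma binary_digit_sum_sum_le:
  assumes "finite A" and "\<And>i. i \<in> A \<Longrightarrow> two_power_or_zero (f i)"
  shows "binary_digit_sum (\<Sum>i\<in>A. f i) \<le> card A"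
  using assms
proof (induction A)
  case (insert i A)
  then have IH: "binary_digit_sum (\<Sum>i\<in>A. f i) \<le> card A" by simp
  consider "f i = 0" | r where "f i = 2 ^ r"
    using insert.prems[of i] by (auto simp: two_power_or_zero_def)
  then show ?case
  proof cases
    case (2 r)
    then show ?thesis
      using insert.hyps IH binary_digit_sum_add_two_power_le[of "\<Sum>i\<in>A. f i" r]
      by (simp add: add.commute)
  qed (use insert.hyps IH in simp)
qed simp

lemma binary_digit_sum_two_power_minus_1: "Suc n = 2 ^ k \<Longrightarrow> binary_digit_sum n = k"
proof (induction k arbitrary: n)
  case (Suc k)
  then have "Suc n = 2 * 2 ^ k" by simp
  then have "Suc (n div 2) = 2 ^ k" "n mod 2 = 1" by presburger+
  then show ?case using Suc.IH[of "n div 2"] by (simp add: binary_digit_sum_rec[of n])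
qed simp

lemma card_ge_if_two_power_sum:
  assumes "finite A" and "\<And>i. i \<in> A \<Longrightarrow> two_power_or_zero (f i)"
    and "Suc (\<Sum>i\<in>A. f i) = 2 ^ k"
  shows "k \<le> card A"
  using binary_digit_sum_sum_le[of A f] binary_digit_sum_two_power_minus_1[OF assms(3)] assms
  by simp

text \<open>
  A pair \<open>(t, n)\<close> stands for the decomposition \<open>2^t + n\<close>; the value is the other decomposition of
  the same number. The pair \<open>(0, 0)\<close> has no partner, and its value is arbitrary.
\<close>

definition other_decomposition :: "nat \<times> nat \<Rightarrow> nat \<times> nat" where
  "other_decomposition = (\<lambda>(t, n).
     if n = 0 then (t - 1, 2 ^ (t - 1))
     else if n = 2 ^ t then (Suc t, 0)
     else (THE s. n = 2 ^ s, 2 ^ t))"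

lemma the_two_power_exponent [simp]: "(THE s. (2::nat) ^ r = 2 ^ s) = r"
  by (rule the_equality) auto

lemma other_decomposition_properties:
  assumes "two_power_or_zero n" and "t > 0 \<or> n > 0" and "other_decomposition (t, n) = (s, m)"
  shows "two_power_or_zero m" and "2 ^ s + m = 2 ^ t + n" and "s \<noteq> t"
    and "s > 0 \<or> m > 0" and "other_decomposition (s, m) = (t, n)"
proof -
  consider "n = 0" "t > 0" | "n = 2 ^ t" | r where "n = 2 ^ r" "r \<noteq> t"
  proof (cases "n = 0")
    case True
    then show thesis using assms(2) that(1) by simp
  next
    case False
    then obtain r where "n = 2 ^ r" using assms(1) by (auto simp: two_power_or_zero_def)
    then show thesis using that(2,3) by (cases "r = t") simp_all
  qed
  then have "two_power_or_zero m \<and> 2 ^ s + m = 2 ^ t + n \<and> s \<noteq> t \<and> (s > 0 \<or> m > 0) \<and>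
      other_decomposition (s, m) = (t, n)"
  proof cases
    case 1
    then obtain u where "t = Suc u" by (cases t) auto
    then show ?thesis using 1 assms(3) by (auto simp: other_decomposition_def)
  qed (use assms(3) in \<open>auto simp: other_decomposition_def\<close>)
  then show "two_power_or_zero m" and "2 ^ s + m = 2 ^ t + n" and "s \<noteq> t"
    and "s > 0 \<or> m > 0" and "other_decomposition (s, m) = (t, n)" by blast+
qed

section \<open>The linear relation between the two-power monomial sums\<close>

lemma F2_mpoly_add_self [simp]: "(p::F2_mpoly) + p = 0"
proof (rule poly_mapping_eqI)
  have "b + b = 0" for b :: bit by (cases b) simp_all
  then show "Poly_Mapping.lookup (p + p) a = Poly_Mapping.lookup 0 a" for a
    by (simp only: lookup_add lookup_zero)
qed

lemma F2_mpoly_eq_if_add_eq_0: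
  assumes "(p::F2_mpoly) + q = 0"
  shows "p = q"
proof -
  have "p + q = q + q" using assms by simp
  then show ?thesis by (rule add_right_imp_eq)
qed

lemma monomial_mult: "monomial a * monomial b = monomial (a + b)"
  by (simp add: monomial_def mult_single)

lemma monomial_0: "monomial 0 = 1"
  by (simp add: monomial_def)

lemma expvecs_iff: "a \<in> expvecs k \<longleftrightarrow> (\<forall>i. i \<notin> {1..k} \<longrightarrow> Poly_Mapping.lookup a i = 0)"
proof -
  have "a \<in> expvecs k \<longleftrightarrow> (\<forall>i. i \<in> Poly_Mapping.keys a \<longrightarrow> i \<in> {1..k})"
    unfolding expvecs_def by blast
  then show ?thesis unfolding in_keys_iff by metis
qed

lemma total_degree_eq_sum:
  assumes "a \<in> expvecs k"
  shows "total_degree a = (\<Sum>i = 1..k. Poly_Mapping.lookup a i)"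
  unfolding total_degree_def
proof (rule sum.mono_neutral_left)
  show "Poly_Mapping.keys a \<subseteq> {1..k}" using assms by (simp add: expvecs_def)
qed (auto simp: in_keys_iff)

definition two_power_sum :: "nat \<Rightarrow> nat \<Rightarrow> F2_mpoly" where
  "two_power_sum k t = (\<Sum>a\<in>two_power_expvecs k (2 ^ k - 2 ^ t). monomial a)"

lemma two_power_expvecs_0: "two_power_expvecs k 0 = {0}"
proof -
  have "a = 0" if "a \<in> expvecs k" "total_degree a = 0" for a
  proof (rule poly_mapping_eqI)
    show "Poly_Mapping.lookup a i = Poly_Mapping.lookup 0 i" for i
      using that by (cases "i \<in> Poly_Mapping.keys a") (auto simp: total_degree_def in_keys_iff)
  qed
  then show ?thesis
    by (auto simp: two_power_expvecs_def expvecs_def total_degree_def)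
qed

lemma two_power_sum_top: "two_power_sum k k = 1"
  by (simp add: two_power_sum_def two_power_expvecs_0 monomial_0)

text \<open>The index set of the terms of \<open>\<Sum>t\<le>k. Q\<^sub>t * x\<^sub>i^(2^t)\<close>.\<close>

definition relation_terms :: "nat \<Rightarrow> (nat \<times> expvec) set" where
  "relation_terms k = Sigma {..k} (\<lambda>t. two_power_expvecs k (2 ^ k - 2 ^ t))"

lemma relation_terms_iff:
  "(t, a) \<in> relation_terms k \<longleftrightarrow>
     a \<in> expvecs k \<and> (\<Sum>i = 1..k. Poly_Mapping.lookup a i) + 2 ^ t = 2 ^ k \<and>
     (\<forall>i. two_power_or_zero (Poly_Mapping.lookup a i))"
proof -
  have le: "2 ^ t \<le> (2::nat) ^ k \<longleftrightarrow> t \<le> k" by simp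
  have supp: "two_power_or_zero (Poly_Mapping.lookup a i)" if "a \<in> expvecs k" "i \<notin> {1..k}" for i
    using that by (simp add: expvecs_iff)
  show ?thesis
  proof (cases "a \<in> expvecs k")
    case True
    have "d = 2 ^ k - 2 ^ t \<and> t \<le> k \<longleftrightarrow> d + 2 ^ t = 2 ^ k" for d :: nat
      using le by (metis add_diff_cancel_right' le_add2 le_add_diff_inverse2)
    moreover have "(\<forall>i. two_power_or_zero (Poly_Mapping.lookup a i)) \<longleftrightarrow>
        (\<forall>i\<in>{1..k}. two_power_or_zero (Poly_Mapping.lookup a i))"
      using supp[OF True] by blast
    ultimately show ?thesis
      using True unfolding relation_terms_def two_power_expvecs_def
      by (auto simp: total_degree_eq_sum two_power_or_zero_def)
  next
    case False
    then show ?thesis by (auto simp: relation_terms_def two_power_expvecs_def)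
  qed
qed

text \<open>
  Otherwise the \<open>k - 1\<close> exponents of \<open>a\<close> away from \<open>i\<close> would have the sum \<open>2^k - 1\<close>, whose \<open>k\<close>
  binary digits are all equal to one.
\<close>

lemma relation_terms_not_both_trivial:
  assumes "i \<in> {1..k}" and "(t, a) \<in> relation_terms k"
  shows "t > 0 \<or> Poly_Mapping.lookup a i > 0"
proof (rule ccontr)
  assume "\<not> ?thesis"
  then have triv: "t = 0" "Poly_Mapping.lookup a i = 0" by auto
  have "Suc (\<Sum>l\<in>{1..k} - {i}. Poly_Mapping.lookup a l) = 2 ^ k"
    using assms triv sum.remove[of "{1..k}" i "Poly_Mapping.lookup a"]
    by (simp add: relation_terms_iff)
  then have "k \<le> card ({1..k} - {i})"
    using assms by (intro card_ge_if_two_power_sum) (auto simp: relation_terms_iff)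
  then show False using assms(1) by (auto simp: card_Diff_singleton)
qed

text \<open>The pairing that cancels the terms of \<open>\<Sum>t\<le>k. Q\<^sub>t * x\<^sub>i^(2^t)\<close>.\<close>

definition term_partner :: "nat \<Rightarrow> nat \<times> expvec \<Rightarrow> nat \<times> expvec" where
  "term_partner i = (\<lambda>(t, a).
     case other_decomposition (t, Poly_Mapping.lookup a i) of
       (s, m) \<Rightarrow> (s, Poly_Mapping.update i m a))"

lemma term_partner_properties:
  assumes i: "i \<in> {1..k}" and ta: "(t, a) \<in> relation_terms k"
    and sb: "term_partner i (t, a) = (s, b)"
  shows "(s, b) \<in> relation_terms k"
    and "b + Poly_Mapping.single i (2 ^ s) = a + Poly_Mapping.single i (2 ^ t)"
    and "term_partner i (s, b) = (t, a)" and "s \<noteq> t"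
proof -
  define n where "n = Poly_Mapping.lookup a i"
  obtain m where m: "other_decomposition (t, n) = (s, m)" and b: "b = Poly_Mapping.update i m a"
    using sb by (auto simp: term_partner_def n_def split: prod.splits)
  have lookup_b: "Poly_Mapping.lookup b l = (if l = i then m else Poly_Mapping.lookup a l)" for l
    by (simp add: b lookup_update)
  have pow: "two_power_or_zero n" and nontriv: "t > 0 \<or> n > 0"
    using ta relation_terms_not_both_trivial[OF i ta] by (auto simp: relation_terms_iff n_def)
  note od = other_decomposition_properties[OF pow nontriv m]
  show eq: "b + Poly_Mapping.single i (2 ^ s) = a + Poly_Mapping.single i (2 ^ t)"
    by (rule poly_mapping_eqI)
      (use od(2) in \<open>auto simp: lookup_add lookup_single lookup_b n_def when_def add.commute\<close>)
  have sum_split: "(\<Sum>l = 1..k. Poly_Mapping.lookup c l) =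
      Poly_Mapping.lookup c i + (\<Sum>l\<in>{1..k} - {i}. Poly_Mapping.lookup c l)" for c :: expvec
    using i by (intro sum.remove) auto
  have "(\<Sum>l\<in>{1..k} - {i}. Poly_Mapping.lookup b l) =
      (\<Sum>l\<in>{1..k} - {i}. Poly_Mapping.lookup a l)"
    by (intro sum.cong) (auto simp: lookup_b)
  then have "(\<Sum>l = 1..k. Poly_Mapping.lookup b l) + 2 ^ s =
      (\<Sum>l = 1..k. Poly_Mapping.lookup a l) + 2 ^ t"
    using od(2) unfolding sum_split[of a] sum_split[of b] by (simp add: lookup_b n_def)
  moreover have "b \<in> expvecs k"
    using ta i by (auto simp: relation_terms_iff expvecs_iff lookup_b)
  ultimately show "(s, b) \<in> relation_terms k"
    using ta od(1) by (simp add: relation_terms_iff lookup_b)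
  have "Poly_Mapping.update i n b = a"
    by (rule poly_mapping_eqI) (auto simp: lookup_update lookup_b n_def)
  then show "term_partner i (s, b) = (t, a)"
    using od(5) by (simp add: term_partner_def lookup_b)
  show "s \<noteq> t" by (rule od(3))
qed

lemma two_power_relation_eq_0:
  assumes i: "i \<in> {1..k}"
  shows "(\<Sum>t\<le>k. two_power_sum k t * monomial (Poly_Mapping.single i (2 ^ t))) = 0"
proof -
  have "(\<Sum>t\<le>k. two_power_sum k t * monomial (Poly_Mapping.single i (2 ^ t))) =
      (\<Sum>(t, a)\<in>relation_terms k. monomial (a + Poly_Mapping.single i (2 ^ t)))"
    unfolding two_power_sum_def relation_terms_def sum_distrib_right monomial_mult
    by (rule sum.Sigma) (auto simp: finite_two_power_expvecs)
  also have "\<dots> = 0"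
  proof (rule sum_involution_eq_0[where h = "term_partner i"])
    fix x assume x: "x \<in> relation_terms k"
    obtain t a s b where ta: "x = (t, a)" and sb: "term_partner i (t, a) = (s, b)"
      by (metis surj_pair)
    note tp = term_partner_properties[OF i x[unfolded ta] sb]
    show "(case term_partner i x of (t, a) \<Rightarrow> monomial (a + Poly_Mapping.single i (2 ^ t))) +
        (case x of (t, a) \<Rightarrow> monomial (a + Poly_Mapping.single i (2 ^ t))) = 0"
      by (simp add: ta sb tp(2))
    show "term_partner i x \<in> relation_terms k" "term_partner i (term_partner i x) = x"
      "term_partner i x \<noteq> x"
      using tp(1,3,4) by (auto simp: ta sb)
  qed
  finally show ?thesis .
qed

lemma two_power_relation:
  assumes "i \<in> {1..k}"
  shows "monomial (Poly_Mapping.single i (2 ^ k)) =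
    (\<Sum>t<k. two_power_sum k t * monomial (Poly_Mapping.single i (2 ^ t)))"
proof (rule F2_mpoly_eq_if_add_eq_0)
  let ?f = "\<lambda>t. two_power_sum k t * monomial (Poly_Mapping.single i (2 ^ t))"
  have "(\<Sum>t\<le>k. ?f t) = (\<Sum>t<k. ?f t) + ?f k"
    by (simp only: lessThan_Suc_atMost[symmetric] sum.lessThan_Suc)
  then show "monomial (Poly_Mapping.single i (2 ^ k)) + (\<Sum>t<k. ?f t) = 0"
    using two_power_relation_eq_0[OF assms] by (simp add: two_power_sum_top add.commute)
qed

section \<open>Permanents in characteristic two\<close>

text \<open>
  \<open>power_permanent k e\<close> is the permanent of the matrix with entry \<open>x\<^sub>r^(e c)\<close> in row \<open>r\<close> and
  column \<open>c\<close>, where rows and columns run over \<open>{1..k}\<close>.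
\<close>

definition permuted_exponents :: "nat \<Rightarrow> (nat \<Rightarrow> nat) \<Rightarrow> (nat \<Rightarrow> nat) \<Rightarrow> expvec" where
  "permuted_exponents k e \<sigma> = (\<Sum>c = 1..k. Poly_Mapping.single (\<sigma> c) (e c))"

definition power_permanent :: "nat \<Rightarrow> (nat \<Rightarrow> nat) \<Rightarrow> F2_mpoly" where
  "power_permanent k e = (\<Sum>\<sigma> | \<sigma> permutes {1..k}. monomial (permuted_exponents k e \<sigma>))"

lemma permuted_exponents_compose:
  assumes "\<tau> permutes {1..k}"
  shows "permuted_exponents k (e \<circ> \<tau>) (\<sigma> \<circ> \<tau>) = permuted_exponents k e \<sigma>"
  unfolding permuted_exponents_def
  using sum.permute[OF assms, of "\<lambda>c. Poly_Mapping.single (\<sigma> c) (e c)"] by (simp add: comp_def)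

lemma lookup_permuted_exponents:
  assumes "\<sigma> permutes {1..k}" and "c \<in> {1..k}"
  shows "Poly_Mapping.lookup (permuted_exponents k e \<sigma>) (\<sigma> c) = e c"
proof -
  have "Poly_Mapping.lookup (permuted_exponents k e \<sigma>) (\<sigma> c) =
      (\<Sum>d = 1..k. if d = c then e d else 0)"
    unfolding permuted_exponents_def lookup_sum
    by (intro sum.cong) (auto simp: lookup_single when_def permutes_inj[OF assms(1)] inj_eq)
  then show ?thesis using assms(2) by simp
qed

lemma power_permanent_permute_columns:
  assumes "\<tau> permutes {1..k}"
  shows "power_permanent k (e \<circ> \<tau>) = power_permanent k e"
  unfolding power_permanent_def
  by (subst sum_permutations_compose_right[OF assms])
     (simp add: permuted_exponents_compose[OF assms])

text \<open>Exchanging the two equal columns pairs off the permutations.\<close>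

lemma power_permanent_equal_columns:
  assumes "c \<in> {1..k}" "d \<in> {1..k}" "c \<noteq> d" and "e c = e d"
  shows "power_permanent k e = 0"
  unfolding power_permanent_def
proof (rule sum_involution_eq_0[where h = "\<lambda>\<sigma>. \<sigma> \<circ> transpose c d"])
  have \<tau>: "transpose c d permutes {1..k}"
    using assms(1,2) by (rule permutes_swap_id)
  have e: "e \<circ> transpose c d = e"
    using assms(4) by (auto simp: fun_eq_iff transpose_def)
  fix \<sigma> assume \<sigma>: "\<sigma> \<in> {\<sigma>. \<sigma> permutes {1..k}}"
  show "monomial (permuted_exponents k e (\<sigma> \<circ> transpose c d)) +
      monomial (permuted_exponents k e \<sigma>) = 0"
    using permuted_exponents_compose[OF \<tau>, of e \<sigma>] by (simp add: e)
  show "\<sigma> \<circ> transpose c d \<in> {\<sigma>. \<sigma> permutes {1..k}}"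
    using \<sigma> \<tau> by (simp add: permutes_compose)
  show "\<sigma> \<circ> transpose c d \<circ> transpose c d = \<sigma>"
    by (simp add: comp_assoc)
  have "\<sigma> c \<noteq> \<sigma> d"
    using \<sigma> assms(3) by (simp add: permutes_inj inj_eq)
  then show "\<sigma> \<circ> transpose c d \<noteq> \<sigma>"
    by (metis comp_apply transpose_apply_first)
qed

text \<open>
  Distinct exponents make distinct permutations give distinct monomials, so that summing over the
  set of monomials is the same as summing over permutations.
\<close>

lemma monomial_sym_eq_power_permanent:
  assumes "distinct ts" and len: "length ts = k"
    and e: "\<And>c. c \<in> {1..k} \<Longrightarrow> ts ! (c - 1) = e c"
  shows "monomial_sym ts = power_permanent k e"
proof -
  have e_inj: "c = d" if "c \<in> {1..k}" "d \<in> {1..k}" "e c = e d" for c d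
  proof -
    have "ts ! (c - 1) = ts ! (d - 1)" using that e by simp
    then have "c - 1 = d - 1"
      using nth_eq_iff_index_eq[OF assms(1), of "c - 1" "d - 1"] that len by fastforce
    then show ?thesis using that by auto
  qed
  have "inj_on (permuted_exponents k e) {\<sigma>. \<sigma> permutes {1..k}}"
  proof (rule inj_onI)
    fix \<sigma> \<rho> assume \<sigma>: "\<sigma> \<in> {\<sigma>. \<sigma> permutes {1..k}}" and \<rho>: "\<rho> \<in> {\<sigma>. \<sigma> permutes {1..k}}"
      and eq: "permuted_exponents k e \<sigma> = permuted_exponents k e \<rho>"
    show "\<sigma> = \<rho>"
    proof
      fix c
      show "\<sigma> c = \<rho> c"
      proof (cases "c \<in> {1..k}")
        case True
        then have "\<sigma> c \<in> \<rho> ` {1..k}"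
          using \<sigma> \<rho> permutes_in_image[of \<sigma> "{1..k}" c] permutes_image[of \<rho> "{1..k}"] by simp
        then obtain d where d: "d \<in> {1..k}" "\<sigma> c = \<rho> d" by blast
        have "e c = e d"
          using lookup_permuted_exponents[of \<sigma> k c e] lookup_permuted_exponents[of \<rho> k d e]
            \<sigma> \<rho> True d eq by simp
        then show ?thesis using e_inj[OF True d(1)] d(2) by simp
      next
        case False
        then show ?thesis using \<sigma> \<rho> by (simp add: permutes_not_in)
      qed
    qed
  qed
  moreover have "permuted_expvecs ts = permuted_exponents k e ` {\<sigma>. \<sigma> permutes {1..k}}"
  proof -
    have "(\<Sum>i = 1..length ts. Poly_Mapping.single (\<sigma> i) (ts ! (i - 1))) =
        permuted_exponents k e \<sigma>" for \<sigma>
      unfolding permuted_exponents_def len by (intro sum.cong) (use e in auto)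
    then show ?thesis unfolding permuted_expvecs_def len by auto
  qed
  ultimately show ?thesis
    by (simp add: monomial_sym_def power_permanent_def sum.reindex)
qed

section \<open>Cramer's rule\<close>

text \<open>
  The column exponents of the numerator of \<open>p_poly\<close>, with \<open>2^t\<close> in place of the exponent of the
  last column. Columns are counted from one and exponents of two from zero, so the columns up to \<open>j\<close>
  are shifted by one, while the omission of \<open>2^j\<close> undoes the shift in the columns after them.
\<close>

definition numerator_columns :: "nat \<Rightarrow> nat \<Rightarrow> nat \<Rightarrow> nat \<Rightarrow> nat" where
  "numerator_columns k j t c = 2 ^ (if c = k then t else if c \<le> j then c - 1 else c)"

lemma p_numerator_eq_power_permanent:
  assumes "j < k" and "k \<le> l"
  shows "p_numerator k l j = power_permanent k (numerator_columns k j l)"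
  unfolding p_numerator_def
proof (rule monomial_sym_eq_power_permanent)
  show "distinct (map (\<lambda>i. 2 ^ i) ([0..<j] @ [Suc j..<k] @ [l]) :: nat list)"
    using assms by (auto simp: distinct_map inj_on_def)
  show "length (map (\<lambda>i. 2 ^ i) ([0..<j] @ [Suc j..<k] @ [l]) :: nat list) = k"
    using assms by simp
  show "map (\<lambda>i. 2 ^ i) ([0..<j] @ [Suc j..<k] @ [l]) ! (c - 1) = numerator_columns k j l c"
    if c: "c \<in> {1..k}" for c
  proof -
    have "([0..<j] @ [Suc j..<k] @ [l]) ! (c - 1) =
        (if c = k then l else if c \<le> j then c - 1 else c)"
      using assms c by (auto simp: nth_append)
    moreover have "c - 1 < length ([0..<j] @ [Suc j..<k] @ [l])" using assms c by auto
    ultimately show ?thesis unfolding numerator_columns_def by (simp only: nth_map)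
  qed
qed

lemma p_denominator_eq_power_permanent:
  "p_denominator k = power_permanent k (\<lambda>c. 2 ^ (c - 1))"
  unfolding p_denominator_def
  by (rule monomial_sym_eq_power_permanent) (auto simp: distinct_map inj_on_def)

lemma power_permanent_numerator_columns_diag:
  assumes "j < k"
  shows "power_permanent k (numerator_columns k j j) = p_denominator k"
proof -
  \<comment> \<open>the cycle moving column \<open>j + 1\<close> of the denominator to the last position\<close>
  define \<tau> where "\<tau> c = (if c = k then Suc j else if j < c \<and> c < k then Suc c else c)" for c
  have "inj_on \<tau> {1..k}" "\<tau> ` {1..k} \<subseteq> {1..k}"
    using assms by (auto simp: \<tau>_def inj_on_def split: if_splits)
  then have "bij_betw \<tau> {1..k} {1..k}"
    by (simp add: bij_betw_def endo_inj_surj)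
  then have \<tau>: "\<tau> permutes {1..k}"
    using assms by (intro bij_imp_permutes) (auto simp: \<tau>_def)
  have "power_permanent k (numerator_columns k j j) = power_permanent k ((\<lambda>c. 2 ^ (c - 1)) \<circ> \<tau>)"
    unfolding power_permanent_def permuted_exponents_def
    by (intro sum.cong arg_cong[of _ _ monomial])
       (auto simp: numerator_columns_def \<tau>_def)
  then show ?thesis
    by (simp only: power_permanent_permute_columns[OF \<tau>] p_denominator_eq_power_permanent)
qed

lemma power_permanent_numerator_columns_off_diag:
  assumes "j < k" "t < k" "t \<noteq> j"
  shows "power_permanent k (numerator_columns k j t) = 0"
proof (rule power_permanent_equal_columns)
  \<comment> \<open>the column of exponent \<open>2^t\<close> among the first \<open>k - 1\<close> columns\<close>
  let ?c = "if t < j then Suc t else t"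
  show "?c \<in> {1..k}" "k \<in> {1..k}" "?c \<noteq> k" using assms by auto
  show "numerator_columns k j t ?c = numerator_columns k j t k"
    using assms by (auto simp: numerator_columns_def)
qed

text \<open>
  The exponent of the last column is \<open>2^k\<close> in every row, so \<open>two_power_relation\<close> rewrites that column
  as a combination of columns whose coefficients \<open>two_power_sum k t\<close> do not depend on the row.
\<close>

lemma expand_last_column:
  assumes "j < k"
  shows "power_permanent k (numerator_columns k j k) =
    (\<Sum>t<k. two_power_sum k t * power_permanent k (numerator_columns k j t))"
proof -
  define rest where "rest \<sigma> =
    (\<Sum>c\<in>{1..k} - {k}. Poly_Mapping.single (\<sigma> c) (numerator_columns k j k c))"
    for \<sigma> :: "nat \<Rightarrow> nat"
  have split: "monomial (permuted_exponents k (numerator_columns k j t) \<sigma>) =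
      monomial (rest \<sigma>) * monomial (Poly_Mapping.single (\<sigma> k) (2 ^ t))" for t \<sigma>
  proof -
    have "(\<Sum>c\<in>{1..k} - {k}. Poly_Mapping.single (\<sigma> c) (numerator_columns k j t c)) = rest \<sigma>"
      unfolding rest_def by (intro sum.cong) (auto simp: numerator_columns_def)
    moreover have "k \<in> {1..k}" using assms by simp
    ultimately have "permuted_exponents k (numerator_columns k j t) \<sigma> =
        Poly_Mapping.single (\<sigma> k) (numerator_columns k j t k) + rest \<sigma>"
      unfolding permuted_exponents_def by (subst sum.remove[of _ k]) simp_all
    moreover have "numerator_columns k j t k = 2 ^ t" by (simp add: numerator_columns_def)
    ultimately show ?thesis by (simp add: monomial_mult add.commute)
  qed
  have "power_permanent k (numerator_columns k j k) =
      (\<Sum>\<sigma> | \<sigma> permutes {1..k}. monomial (rest \<sigma>) *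
         (\<Sum>t<k. two_power_sum k t * monomial (Poly_Mapping.single (\<sigma> k) (2 ^ t))))"
    unfolding power_permanent_def
  proof (rule sum.cong[OF refl])
    fix \<sigma> assume "\<sigma> \<in> {\<sigma>. \<sigma> permutes {1..k}}"
    then have "\<sigma> k \<in> {1..k}"
      using assms permutes_in_image[of \<sigma> "{1..k}" k] by simp
    then show "monomial (permuted_exponents k (numerator_columns k j k) \<sigma>) = monomial (rest \<sigma>) *
        (\<Sum>t<k. two_power_sum k t * monomial (Poly_Mapping.single (\<sigma> k) (2 ^ t)))"
      by (simp only: split two_power_relation)
  qed
  also have "\<dots> = (\<Sum>t<k. two_power_sum k t *
      (\<Sum>\<sigma> | \<sigma> permutes {1..k}. monomial (rest \<sigma>) * monomial (Poly_Mapping.single (\<sigma> k) (2 ^ t))))"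
    unfolding sum_distrib_left
    by (subst sum.swap) (simp only: mult.left_commute)
  finally show ?thesis by (simp only: power_permanent_def split)
qed

lemma p_numerator_eq_two_power_sum_times_p_denominator:
  assumes "j < k"
  shows "p_numerator k k j = two_power_sum k j * p_denominator k"
proof -
  have "p_numerator k k j =
      (\<Sum>t<k. two_power_sum k t * power_permanent k (numerator_columns k j t))"
    using assms by (simp add: p_numerator_eq_power_permanent expand_last_column)
  also have "\<dots> = (\<Sum>t<k. if t = j then two_power_sum k j * p_denominator k else 0)"
    using assms
    by (intro sum.cong)
       (auto simp: power_permanent_numerator_columns_diag power_permanent_numerator_columns_off_diag)
  finally show ?thesis using assms by simp
qed

theorem theorem1p5:
  fixes k j :: nat
  assumes "k \<ge> 1" and "0 \<le> j" and "j \<le> k - 1"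
  shows "p_poly k k j = (\<Sum>a\<in>two_power_expvecs k (2 ^ k - 2 ^ j). monomial a)"
proof -
  have "Poly_Mapping.keys (two_power_sum k j) \<subseteq> two_power_expvecs k (2 ^ k - 2 ^ j)"
    by (auto simp: two_power_sum_def in_keys_iff lookup_monomial_sum[OF finite_two_power_expvecs]
        split: if_splits)
  then have "two_power_sum k j \<in> F2_poly_ring k"
    by (auto simp: F2_poly_ring_def two_power_expvecs_def)
  then have "p_poly k k j = two_power_sum k j"
    using assms p_numerator_eq_two_power_sum_times_p_denominator[of j k]
    by (intro p_poly_unique) auto
  then show ?thesis by (simp only: two_power_sum_def)
qed

end
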